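(* Let $g\ge 4$ be an even integer and let $m>g(g-1)$ be an odd integer not divisible by $g-1$. Let $G_{m,g}=\{g^j \bmod m : j=0,1,2,\dots\}\subseteq\mathbb{Z}_m$. If at least one of the residues $g+1,g+2,\dots,g(g-1)$ modulo $m$ belongs to $G_{m,g}$, then $m$ is complete (with respect to $g$).
   Context: Fix an even integer $g\ge4$. For an odd integer $m\ge1$, an extreme cycle for the digit set $\{0,m\}$ is a finite set of distinct integers $\{x_0,\dots,x_{r-1}\}$ together with digits $l_0,\dots,l_{r-1}\in\{0,m\}$ such that $x_{j+1}=(x_j+l_j)/g$ for $0\le j\le r-2$ and $x_0=(x_{r-1}+l_{r-1})/g$. The cycle $\{0\}$ (with digit $0$) is the trivial extreme cycle. The number $m$ is complete if the only extreme cycle for $\{0,m\}$ is the trivial one, and incomplete otherwise. *)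

theory Defs
  imports Complex_Main
begin

text \<open>
  A cycle is a nonempty list of points \<open>x\<^sub>0, \<dots>, x\<^sub>r\<^sub>-\<^sub>1\<close> with the equally long list of their digits; reducing
  the index modulo \<open>r\<close> covers the closing equation for \<open>x\<^sub>0\<close>. The equations are read in the reals,
  so that the quotients by \<open>g\<close> are exact.
\<close>

definition extreme_cycle :: "int \<Rightarrow> int \<Rightarrow> int list \<Rightarrow> int list \<Rightarrow> bool" where
  "extreme_cycle g m xs ls \<longleftrightarrow>
     xs \<noteq> [] \<and> distinct xs \<and> length ls = length xs \<and> set ls \<subseteq> {0, m} \<and>
     (\<forall>j < length xs.
        real_of_int (xs ! (Suc j mod length xs)) =
          (real_of_int (xs ! j) + real_of_int (ls ! j)) / real_of_int g)"

lemma extreme_cycle_trivial: "extreme_cycle g m [0] [0]"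
  by (simp add: extreme_cycle_def)

definition complete_number :: "int \<Rightarrow> int \<Rightarrow> bool" where
  "complete_number g m \<longleftrightarrow> (\<forall>xs ls. extreme_cycle g m xs ls \<longrightarrow> xs = [0] \<and> ls = [0])"

text \<open>Elements of \<open>\<int>\<^sub>m\<close> are represented by their least nonnegative residues.\<close>

definition power_residues :: "int \<Rightarrow> int \<Rightarrow> int set" where
  "power_residues m g = {g ^ j mod m | j :: nat. True}"

end

theory Submission
  imports Defs
begin

text \<open>
  Reading the cycle equations backwards, multiplication by \<open>g\<close> modulo \<open>m\<close> maps the point set of a
  cycle into itself, hence so does multiplication by every residue \<open>a\<close> in the multiplicative orbit
  of \<open>g\<close>. All points lie in \<open>[0, m / (g - 1))\<close>. The largest point \<open>X\<close> must carry the digit \<open>0\<close>, since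
  with the digit \<open>m\<close> its successor would be larger; so \<open>X / g\<close> is a point as well. If \<open>X > 0\<close> and
  \<open>g < a \<le> g (g - 1)\<close>, then \<open>X < a X / g < m\<close>, so the point \<open>a X / g\<close> exceeds the largest one.
\<close>

lemma extreme_cycle_step:
  assumes "extreme_cycle g m xs ls" "g > 0" "j < length xs"
  shows "g * xs ! (Suc j mod length xs) = xs ! j + ls ! j"
proof -
  have "real_of_int (xs ! (Suc j mod length xs)) = (real_of_int (xs ! j) + real_of_int (ls ! j)) / real_of_int g"
    using assms unfolding extreme_cycle_def by blast
  then have "real_of_int (g * xs ! (Suc j mod length xs)) = real_of_int (xs ! j + ls ! j)"
    using assms(2) by (simp add: field_simps)
  then show ?thesis
    by (simp only: of_int_eq_iff)
qed

lemma extreme_cycle_digit: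
  assumes "extreme_cycle g m xs ls" "j < length xs"
  shows "ls ! j = 0 \<or> ls ! j = m"
proof -
  have "ls ! j \<in> set ls"
    using assms by (simp add: extreme_cycle_def)
  moreover have "set ls \<subseteq> {0, m}"
    using assms(1) by (simp add: extreme_cycle_def)
  ultimately show ?thesis
    by blast
qed

lemma extreme_cycle_successor:
  assumes "extreme_cycle g m xs ls" "g > 0" "x \<in> set xs"
  obtains y l where "y \<in> set xs" "l = 0 \<or> l = m" "g * y = x + l"
proof -
  obtain j where j: "j < length xs" "xs ! j = x"
    using assms(3) by (auto simp: in_set_conv_nth)
  then have "Suc j mod length xs < length xs"
    by (intro mod_less_divisor) auto
  then show ?thesis
    using that[of "xs ! (Suc j mod length xs)" "ls ! j"] j
      extreme_cycle_step[OF assms(1,2) j(1)] extreme_cycle_digit[OF assms(1) j(1)] by auto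
qed

lemma extreme_cycle_predecessor:
  assumes "extreme_cycle g m xs ls" "g > 0" "x \<in> set xs"
  obtains y l where "y \<in> set xs" "l = 0 \<or> l = m" "g * x = y + l"
proof -
  obtain i where i: "i < length xs" "xs ! i = x"
    using assms(3) by (auto simp: in_set_conv_nth)
  \<comment> \<open>Cyclic predecessor of \<open>i\<close>: index 0 wraps around to the last
    position.\<close>
  define j where "j = (if i = 0 then length xs - 1 else i - 1)"
  have j: "j < length xs" and "Suc j mod length xs = i"
    using i(1) by (auto simp: j_def)
  then show ?thesis
    using that[of "xs ! j" "ls ! j"] i
      extreme_cycle_step[OF assms(1,2) j] extreme_cycle_digit[OF assms(1) j] by auto
qed

text \<open>Apply the predecessor equation at the two extremes: the minimum satisfies
  \<open>g * Min \<ge> Min\<close>, because digits are nonnegative, and the maximum satisfies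
  \<open>g * Max \<le> Max + m\<close>.\<close>

lemma extreme_cycle_bounds:
  assumes cyc: "extreme_cycle g m xs ls" and "g > 1" "m > 0" and x: "x \<in> set xs"
  shows "0 \<le> x" and "(g - 1) * x \<le> m"
proof -
  have fin: "finite (set xs)" and ne: "set xs \<noteq> {}"
    using x by auto
  obtain y l where y: "y \<in> set xs" "l = 0 \<or> l = m" "g * Min (set xs) = y + l"
    using extreme_cycle_predecessor[OF cyc _ Min_in[OF fin ne]] \<open>g > 1\<close> by auto
  have "Min (set xs) \<le> y"
    using y(1) by simp
  then have "0 \<le> (g - 1) * Min (set xs)"
    using y(2,3) \<open>m > 0\<close> by (auto simp: algebra_simps)
  then have "0 \<le> Min (set xs)"
    using \<open>g > 1\<close> by (simp add: zero_le_mult_iff)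
  then show "0 \<le> x"
    using Min_le[OF fin x] by linarith
  obtain z k where z: "z \<in> set xs" "k = 0 \<or> k = m" "g * Max (set xs) = z + k"
    using extreme_cycle_predecessor[OF cyc _ Max_in[OF fin ne]] \<open>g > 1\<close> by auto
  have "z \<le> Max (set xs)"
    using z(1) by simp
  then have "(g - 1) * Max (set xs) \<le> m"
    using z(2,3) \<open>m > 0\<close> by (auto simp: algebra_simps)
  moreover have "(g - 1) * x \<le> (g - 1) * Max (set xs)"
    using \<open>g > 1\<close> x by (intro mult_left_mono) auto
  ultimately show "(g - 1) * x \<le> m"
    by linarith
qed

text \<open>Equality in the upper bound would make \<open>g - 1\<close> divide \<open>m\<close>.
  Together with nonnegativity, \<open>x < m\<close> makes each point its own residue modulo
  \<open>m\<close>.\<close>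

lemma extreme_cycle_less:
  assumes "extreme_cycle g m xs ls" "g > 1" "m > 0" "\<not> (g - 1) dvd m" "x \<in> set xs"
  shows "(g - 1) * x < m" and "x < m"
proof -
  have "(g - 1) * x \<noteq> m"
    using assms(4) by auto
  then show less: "(g - 1) * x < m"
    using extreme_cycle_bounds(2)[OF assms(1-3,5)] by linarith
  have "1 * x \<le> (g - 1) * x"
    using extreme_cycle_bounds(1)[OF assms(1-3,5)] \<open>g > 1\<close> by (intro mult_right_mono) auto
  then show "x < m"
    using less by linarith
qed

text \<open>The predecessor \<open>y\<close> of a point \<open>x\<close> is congruent to
  \<open>g * x\<close> modulo \<open>m\<close>, and since \<open>0 \<le> y < m\<close> it equals
  that residue. Iterate.\<close>

lemma extreme_cycle_power_mult:
  assumes cyc: "extreme_cycle g m xs ls" and g: "g > 1" and m: "m > 0"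
    and ndvd: "\<not> (g - 1) dvd m" and x: "x \<in> set xs"
  shows "(g ^ n * x) mod m \<in> set xs"
proof (induction n)
  case 0
  show ?case
    using extreme_cycle_bounds(1)[OF cyc g m x] extreme_cycle_less(2)[OF cyc g m ndvd x] x
    by simp
next
  case (Suc n)
  obtain y l where y: "y \<in> set xs" "l = 0 \<or> l = m" "g * (g ^ n * x mod m) = y + l"
    using extreme_cycle_predecessor[OF cyc _ Suc.IH] g by auto
  have "(g ^ Suc n * x) mod m = (g * (g ^ n * x mod m)) mod m"
    by (simp add: mod_mult_right_eq mult.assoc)
  also have "\<dots> = y mod m"
    using y(2,3) by auto
  also have "\<dots> = y"
    using extreme_cycle_bounds(1)[OF cyc g m y(1)] extreme_cycle_less(2)[OF cyc g m ndvd y(1)]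
    by simp
  finally show ?case
    using y(1) by simp
qed

lemma extreme_cycle_of_zeros:
  assumes cyc: "extreme_cycle g m xs ls" and "g > 0" and zero: "set xs \<subseteq> {0}"
  shows "xs = [0] \<and> ls = [0]"
proof -
  have "xs \<noteq> []" "distinct xs" and len: "length ls = length xs"
    using cyc by (auto simp: extreme_cycle_def)
  then have xs: "xs = [0]"
    using zero by (cases xs; cases "tl xs") auto
  then obtain l where "ls = [l]"
    using len by (auto simp: length_Suc_conv)
  \<comment> \<open>The single point 0 is its own successor, so its equation forces the digit
    \<open>l\<close> to be 0.\<close>
  then show ?thesis
    using xs extreme_cycle_step[OF cyc \<open>g > 0\<close>, of 0] by simp
qed

theorem theorem2p13:
  fixes g m :: int
  assumes "g \<ge> 4" and "even g"
    and "odd m" and "m > g * (g - 1)" and "\<not> (g - 1) dvd m"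
    and "\<exists>a \<in> {g + 1 .. g * (g - 1)}. a mod m \<in> power_residues m g"
  shows "complete_number g m"
  unfolding complete_number_def
proof (intro allI impI)
  fix xs ls
  assume cyc: "extreme_cycle g m xs ls"
  have g: "g > 1" "g > 0"
    using \<open>g \<ge> 4\<close> by auto
  have "0 \<le> g * (g - 1)"
    using g by simp
  then have m: "m > 0"
    using \<open>m > g * (g - 1)\<close> by linarith
  note ndvd = \<open>\<not> (g - 1) dvd m\<close>
  note bounds = extreme_cycle_bounds(1)[OF cyc g(1) m] extreme_cycle_less(1)[OF cyc g(1) m ndvd]
  obtain a n where a: "g + 1 \<le> a" "a \<le> g * (g - 1)" and an: "a mod m = g ^ n mod m"
    using assms(6) by (auto simp: power_residues_def)
  define X where "X = Max (set xs)"
  have "xs \<noteq> []"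
    using cyc by (simp add: extreme_cycle_def)
  then have X_in: "X \<in> set xs"
    by (simp add: X_def)
  have X_max: "x \<le> X" if "x \<in> set xs" for x
    using that by (simp add: X_def)
  obtain w l where w: "w \<in> set xs" "l = 0 \<or> l = m" "g * w = X + l"
    using extreme_cycle_successor[OF cyc g(2) X_in] by blast
  have "g * w \<le> g * X"
    using X_max[OF w(1)] g by simp
  \<comment> \<open>With \<open>l = m\<close>, the bound \<open>(g - 1) * X < m\<close> would give
    \<open>g * w = X + m > g * X\<close>.\<close>
  then have "l \<noteq> m"
    using w(3) bounds(2)[OF X_in] by (auto simp: algebra_simps)
  then have gw: "g * w = X"
    using w(2,3) by simp
  \<comment> \<open>The upper limit on \<open>a\<close> keeps \<open>a * w\<close> below
    \<open>m\<close>, so reduction modulo \<open>m\<close> leaves it unchanged.\<close>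
  have "a * w \<le> g * (g - 1) * w"
    using a(2) bounds(1)[OF w(1)] by (rule mult_right_mono)
  also have "\<dots> = (g - 1) * X"
    using gw by (simp add: mult_ac)
  also have "\<dots> < m"
    by (rule bounds(2)[OF X_in])
  finally have "a * w < m" .
  moreover have "0 \<le> a * w"
    using a(1) g bounds(1)[OF w(1)] by simp
  ultimately have "a * w = (a mod m * w) mod m"
    by (simp add: mod_mult_left_eq)
  also have "\<dots> = (g ^ n * w) mod m"
    by (simp add: an mod_mult_left_eq)
  also have "\<dots> \<in> set xs"
    by (rule extreme_cycle_power_mult[OF cyc g(1) m ndvd w(1)])
  finally have "a * w \<le> X"
    by (rule X_max)
  \<comment> \<open>Here \<open>a > g\<close> enters: \<open>(g + 1) * w \<le> X = g * w\<close>
    leaves no room for a positive \<open>w\<close>.\<close>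
  moreover have "(g + 1) * w \<le> a * w"
    using a(1) bounds(1)[OF w(1)] by (rule mult_right_mono)
  ultimately have "w \<le> 0"
    using gw by (simp add: algebra_simps)
  then have "X = 0"
    using bounds(1)[OF w(1)] gw by simp
  then have "set xs \<subseteq> {0}"
    using X_max bounds(1) by force
  then show "xs = [0] \<and> ls = [0]"
    by (rule extreme_cycle_of_zeros[OF cyc g(2)])
qed

end
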